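(* Let $n>1$ be an integer. Then $$\operatorname{diam}(\overline{\Gamma}(\mathbb{Z}_n[i,j,k]))=\operatorname{diam}(\Gamma(\mathbb{Z}_n[i,j,k]))=\begin{cases}2, & \text{if } n \text{ is a prime power};\\ 3, & \text{otherwise}.\end{cases}$$
   Context: $\mathbb{Z}_n[i,j,k]=\{a+bi+cj+dk: a,b,c,d\in\mathbb{Z}_n\}$ is the ring of Lipschitz quaternions modulo $n$, with $i^2=j^2=k^2=ijk=-1$ and coefficients in $\mathbb{Z}_n$ (integers modulo $n$) central. For a ring $R$, an element $x$ is a zero divisor if there is a nonzero $y\in R$ with $xy=0$ or $yx=0$; $Z(R)^*$ denotes the set of nonzero zero divisors. The directed zero divisor graph $\Gamma(R)$ has vertex set $Z(R)^*$ and a directed edge $x\to y$ for distinct $x,y$ iff $xy=0$. The undirected zero divisor graph $\overline{\Gamma}(R)$ has the same vertex set, with distinct $x,y$ adjacent iff $xy=0$ or $yx=0$. The distance $d(a,b)$ between distinct vertices is the length of a shortest path (a shortest directed path from $a$ to $b$ in the directed case), or infinity if none exists; the diameter is the supremum of $d(a,b)$ over all (ordered) pairs of distinct vertices. *)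

theory Defs
  imports
    "HOL-Number_Theory.Number_Theory"
    "Graph_Theory.Arc_Walk"
    "HOL-Library.Extended_Nat"
begin

text \<open>The quadruple \<open>(a, b, c, d)\<close> stands for $a + bi + cj + dk$; the multiplication is the
  bilinear extension of $i^2 = j^2 = k^2 = ijk = -1$ with central coefficients.\<close>

definition quaternion_ring ::
    "('a, 'm) ring_scheme \<Rightarrow> ('a \<times> 'a \<times> 'a \<times> 'a) ring" where
  "quaternion_ring R =
    \<lparr>carrier = carrier R \<times> carrier R \<times> carrier R \<times> carrier R,
     monoid.mult = (\<lambda>(a, b, c, d) (a', b', c', d').
       (a \<otimes>\<^bsub>R\<^esub> a' \<ominus>\<^bsub>R\<^esub> b \<otimes>\<^bsub>R\<^esub> b' \<ominus>\<^bsub>R\<^esub> c \<otimes>\<^bsub>R\<^esub> c' \<ominus>\<^bsub>R\<^esub> d \<otimes>\<^bsub>R\<^esub> d',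
        a \<otimes>\<^bsub>R\<^esub> b' \<oplus>\<^bsub>R\<^esub> b \<otimes>\<^bsub>R\<^esub> a' \<oplus>\<^bsub>R\<^esub> c \<otimes>\<^bsub>R\<^esub> d' \<ominus>\<^bsub>R\<^esub> d \<otimes>\<^bsub>R\<^esub> c',
        a \<otimes>\<^bsub>R\<^esub> c' \<ominus>\<^bsub>R\<^esub> b \<otimes>\<^bsub>R\<^esub> d' \<oplus>\<^bsub>R\<^esub> c \<otimes>\<^bsub>R\<^esub> a' \<oplus>\<^bsub>R\<^esub> d \<otimes>\<^bsub>R\<^esub> b',
        a \<otimes>\<^bsub>R\<^esub> d' \<oplus>\<^bsub>R\<^esub> b \<otimes>\<^bsub>R\<^esub> c' \<ominus>\<^bsub>R\<^esub> c \<otimes>\<^bsub>R\<^esub> b' \<oplus>\<^bsub>R\<^esub> d \<otimes>\<^bsub>R\<^esub> a')),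
     one = (\<one>\<^bsub>R\<^esub>, \<zero>\<^bsub>R\<^esub>, \<zero>\<^bsub>R\<^esub>, \<zero>\<^bsub>R\<^esub>),
     zero = (\<zero>\<^bsub>R\<^esub>, \<zero>\<^bsub>R\<^esub>, \<zero>\<^bsub>R\<^esub>, \<zero>\<^bsub>R\<^esub>),
     add = (\<lambda>(a, b, c, d) (a', b', c', d').
       (a \<oplus>\<^bsub>R\<^esub> a', b \<oplus>\<^bsub>R\<^esub> b', c \<oplus>\<^bsub>R\<^esub> c', d \<oplus>\<^bsub>R\<^esub> d'))\<rparr>"

lemma (in cring) quaternion_ring_is_ring: "ring (quaternion_ring R)"
proof (rule ringI)
  show "abelian_group (quaternion_ring R)"
  proof (rule abelian_groupI)
    fix x assume "x \<in> carrier (quaternion_ring R)"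
    then obtain a b c d where x: "x = (a, b, c, d)"
      and abcd: "a \<in> carrier R" "b \<in> carrier R" "c \<in> carrier R" "d \<in> carrier R"
      by (auto simp: quaternion_ring_def)
    show "\<exists>y\<in>carrier (quaternion_ring R). y \<oplus>\<^bsub>quaternion_ring R\<^esub> x = \<zero>\<^bsub>quaternion_ring R\<^esub>"
      by (rule bexI[of _ "(\<ominus> a, \<ominus> b, \<ominus> c, \<ominus> d)"])
        (use abcd in \<open>auto simp: x quaternion_ring_def l_neg\<close>)
  qed (auto simp: quaternion_ring_def a_ac)
  show "Group.monoid (quaternion_ring R)"
  proof (rule monoidI, goal_cases)
    case (3 x y z)
    obtain a b c d where x: "x = (a, b, c, d)" by (rule prod_cases4)
    obtain a' b' c' d' where y: "y = (a', b', c', d')" by (rule prod_cases4)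
    obtain a'' b'' c'' d'' where z: "z = (a'', b'', c'', d'')" by (rule prod_cases4)
    show ?case
      using 3 unfolding x y z quaternion_ring_def
      apply (simp add: minus_eq l_distr r_distr l_minus r_minus minus_add m_assoc)
      apply (simp add: a_ac)
      done
  qed (auto simp: quaternion_ring_def ring_simprules)
next
  fix x y z
  assume *: "x \<in> carrier (quaternion_ring R)" "y \<in> carrier (quaternion_ring R)"
    "z \<in> carrier (quaternion_ring R)"
  obtain a b c d where x: "x = (a, b, c, d)" by (rule prod_cases4)
  obtain a' b' c' d' where y: "y = (a', b', c', d')" by (rule prod_cases4)
  obtain a'' b'' c'' d'' where z: "z = (a'', b'', c'', d'')" by (rule prod_cases4)
  show "(x \<oplus>\<^bsub>quaternion_ring R\<^esub> y) \<otimes>\<^bsub>quaternion_ring R\<^esub> z =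
      x \<otimes>\<^bsub>quaternion_ring R\<^esub> z \<oplus>\<^bsub>quaternion_ring R\<^esub> y \<otimes>\<^bsub>quaternion_ring R\<^esub> z"
    using * unfolding x y z quaternion_ring_def
    by (simp add: minus_eq l_distr minus_add a_ac)
  show "z \<otimes>\<^bsub>quaternion_ring R\<^esub> (x \<oplus>\<^bsub>quaternion_ring R\<^esub> y) =
      z \<otimes>\<^bsub>quaternion_ring R\<^esub> x \<oplus>\<^bsub>quaternion_ring R\<^esub> z \<otimes>\<^bsub>quaternion_ring R\<^esub> y"
    using * unfolding x y z quaternion_ring_def
    by (simp add: minus_eq r_distr minus_add a_ac)
qed

lemma (in cring) quaternion_units:
  fixes Q (structure)
  defines "Q \<equiv> quaternion_ring R"
  defines "qi \<equiv> (\<zero>\<^bsub>R\<^esub>, \<one>\<^bsub>R\<^esub>, \<zero>\<^bsub>R\<^esub>, \<zero>\<^bsub>R\<^esub>)"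
    and "qj \<equiv> (\<zero>\<^bsub>R\<^esub>, \<zero>\<^bsub>R\<^esub>, \<one>\<^bsub>R\<^esub>, \<zero>\<^bsub>R\<^esub>)"
    and "qk \<equiv> (\<zero>\<^bsub>R\<^esub>, \<zero>\<^bsub>R\<^esub>, \<zero>\<^bsub>R\<^esub>, \<one>\<^bsub>R\<^esub>)"
  shows "qi \<otimes>\<^bsub>Q\<^esub> qi = \<ominus>\<^bsub>Q\<^esub> \<one>\<^bsub>Q\<^esub>"
    and "qj \<otimes>\<^bsub>Q\<^esub> qj = \<ominus>\<^bsub>Q\<^esub> \<one>\<^bsub>Q\<^esub>"
    and "qk \<otimes>\<^bsub>Q\<^esub> qk = \<ominus>\<^bsub>Q\<^esub> \<one>\<^bsub>Q\<^esub>"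
    and "qi \<otimes>\<^bsub>Q\<^esub> qj \<otimes>\<^bsub>Q\<^esub> qk = \<ominus>\<^bsub>Q\<^esub> \<one>\<^bsub>Q\<^esub>"
proof -
  interpret Q: ring Q
    unfolding Q_def by (rule quaternion_ring_is_ring)
  have "\<ominus>\<^bsub>Q\<^esub> \<one>\<^bsub>Q\<^esub> = (\<ominus>\<^bsub>R\<^esub> \<one>\<^bsub>R\<^esub>, \<zero>\<^bsub>R\<^esub>, \<zero>\<^bsub>R\<^esub>, \<zero>\<^bsub>R\<^esub>)"
    by (rule Q.minus_equality) (auto simp: Q_def quaternion_ring_def l_neg)
  then show "qi \<otimes>\<^bsub>Q\<^esub> qi = \<ominus>\<^bsub>Q\<^esub> \<one>\<^bsub>Q\<^esub>"
    and "qj \<otimes>\<^bsub>Q\<^esub> qj = \<ominus>\<^bsub>Q\<^esub> \<one>\<^bsub>Q\<^esub>"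
    and "qk \<otimes>\<^bsub>Q\<^esub> qk = \<ominus>\<^bsub>Q\<^esub> \<one>\<^bsub>Q\<^esub>"
    and "qi \<otimes>\<^bsub>Q\<^esub> qj \<otimes>\<^bsub>Q\<^esub> qk = \<ominus>\<^bsub>Q\<^esub> \<one>\<^bsub>Q\<^esub>"
    unfolding qi_def qj_def qk_def
    by (auto simp: Q_def quaternion_ring_def ring_simprules)
qed

definition quaternions_mod :: "nat \<Rightarrow> (int \<times> int \<times> int \<times> int) ring" where
  "quaternions_mod n = quaternion_ring (residue_ring (int n))"

text \<open>The infimum of the empty set is \<open>\<infinity>\<close> in \<^typ>\<open>enat\<close>, which covers unreachable vertices.\<close>

definition digraph_dist :: "('a, 'b) pre_digraph \<Rightarrow> 'a \<Rightarrow> 'a \<Rightarrow> enat" where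
  "digraph_dist G u v = (INF p \<in> {p. pre_digraph.apath G u p v}. enat (length p))"

definition digraph_diameter :: "('a, 'b) pre_digraph \<Rightarrow> enat" where
  "digraph_diameter G =
    (SUP (u, v) \<in> {(u, v). u \<in> verts G \<and> v \<in> verts G \<and> u \<noteq> v}. digraph_dist G u v)"

definition nonzero_zero_divisors :: "('a, 'm) ring_scheme \<Rightarrow> 'a set" where
  "nonzero_zero_divisors R =
    {x \<in> carrier R. x \<noteq> \<zero>\<^bsub>R\<^esub> \<and>
      (\<exists>y \<in> carrier R. y \<noteq> \<zero>\<^bsub>R\<^esub> \<and> (x \<otimes>\<^bsub>R\<^esub> y = \<zero>\<^bsub>R\<^esub> \<or> y \<otimes>\<^bsub>R\<^esub> x = \<zero>\<^bsub>R\<^esub>))}"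

definition zero_divisor_digraph ::
    "('a, 'm) ring_scheme \<Rightarrow> ('a, 'a \<times> 'a) pre_digraph" where
  "zero_divisor_digraph R =
    \<lparr>verts = nonzero_zero_divisors R,
     arcs = {(x, y). x \<in> nonzero_zero_divisors R \<and> y \<in> nonzero_zero_divisors R \<and>
       x \<noteq> y \<and> x \<otimes>\<^bsub>R\<^esub> y = \<zero>\<^bsub>R\<^esub>},
     tail = fst, head = snd\<rparr>"

text \<open>The undirected graph is encoded as a symmetric digraph, one arc in each direction per edge.\<close>

definition zero_divisor_graph ::
    "('a, 'm) ring_scheme \<Rightarrow> ('a, 'a \<times> 'a) pre_digraph" where
  "zero_divisor_graph R =
    \<lparr>verts = nonzero_zero_divisors R,
     arcs = {(x, y). x \<in> nonzero_zero_divisors R \<and> y \<in> nonzero_zero_divisors R \<and>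
       x \<noteq> y \<and> (x \<otimes>\<^bsub>R\<^esub> y = \<zero>\<^bsub>R\<^esub> \<or> y \<otimes>\<^bsub>R\<^esub> x = \<zero>\<^bsub>R\<^esub>)},
     tail = fst, head = snd\<rparr>"

lemma wf_zero_divisor_digraph: "wf_digraph (zero_divisor_digraph R)"
  by unfold_locales (auto simp: zero_divisor_digraph_def)

lemma sym_zero_divisor_graph: "sym_digraph (zero_divisor_graph R)"
  by unfold_locales
    (auto simp: zero_divisor_graph_def symmetric_def arcs_ends_def arc_to_ends_def sym_def)

end

theory Submission
  imports Defs
begin

text \<open>
  The ring of quaternions modulo \<open>n\<close> is finite, and in a finite ring a zero divisor \<open>u\<close> is always a
  zero divisor on both sides: an element that is not killed from one side acts injectively, hence
  surjectively, and so is invertible. Given zero divisors \<open>u\<close> and \<open>v\<close>, choose nonzero \<open>c\<close>, \<open>d\<close> with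
  \<open>u c = 0\<close> and \<open>d v = 0\<close>. Either \<open>c d = 0\<close>, and \<open>u \<rightarrow> c \<rightarrow> d \<rightarrow> v\<close> is a walk, or \<open>c d\<close> is nonzero and
  \<open>u \<rightarrow> c d \<rightarrow> v\<close> is one. So both diameters are at most 3 (\<open>diameter_zero_divisor_digraph_le_3\<close>).

  If \<open>n = p ^ Suc e\<close>, the zero divisors are quaternions whose norm is divisible by \<open>p\<close>. It suffices
  to find \<open>c\<close>, nonzero modulo \<open>p\<close>, with \<open>u c = 0 = c v\<close> modulo \<open>p\<close>: then \<open>p ^ e c\<close> is a vertex
  between \<open>u\<close> and \<open>v\<close>. For \<open>p = 2\<close> the element \<open>1 + i + j + k\<close> is killed by everything of even norm.
  For odd \<open>p\<close> the quaternions over the field with \<open>p\<close> elements form a prime ring (in fact a matrix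
  ring), so \<open>c\<close> can be taken of the form \<open>u\<^sup>* q v\<^sup>*\<close>, where \<open>*\<close> is conjugation
  (\<open>exists_common_annihilator_mod_prime\<close>). Hence the directed diameter is at most 2.

  The lower bounds are proved for the undirected graph, whose diameter is the smaller one. They use
  that every prime \<open>p\<close> divides some \<open>1 + r\<^sup>2 + s\<^sup>2\<close>, the norm of \<open>x = 1 + r i + s j\<close>. For \<open>n\<close> a power
  of an odd \<open>p\<close>, the vertices \<open>x\<close> and \<open>- x\<close> are not adjacent, because \<open>x\<^sup>2\<close> is congruent to \<open>2 x\<close>
  modulo \<open>p\<close>; for \<open>p = 2\<close> the vertices \<open>1 + i\<close> and \<open>1 + j\<close> serve. If \<open>n = p ^ e k\<close> with \<open>k > 1\<close>
  prime to \<open>p\<close>, arrange that \<open>k\<close> divides \<open>r\<close> and \<open>s\<close>. Then \<open>x\<close> and the scalar \<open>k\<close> are not adjacent,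
  and a common neighbour would vanish modulo \<open>k\<close>, where \<open>x\<close> is invertible, and modulo \<open>p ^ e\<close>, where
  \<open>k\<close> is; so it would be zero. Their distance is therefore at least 3.
\<close>

section \<open>Distances in the digraph of a relation\<close>

text \<open>
  The common shape of the directed and the undirected zero divisor graph.
\<close>

definition relation_digraph :: "'a set \<Rightarrow> ('a \<Rightarrow> 'a \<Rightarrow> bool) \<Rightarrow> ('a, 'a \<times> 'a) pre_digraph" where
  "relation_digraph V E =
    \<lparr>verts = V, arcs = {(x, y). x \<in> V \<and> y \<in> V \<and> x \<noteq> y \<and> E x y}, tail = fst, head = snd\<rparr>"

text \<open>
  Allowing the walker to rest at a vertex makes the \<open>k\<close>-th relational power describe distance at
  most \<open>k\<close>, instead of walks of length exactly \<open>k\<close>; it also spares every argument below the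
  degenerate cases in which consecutive vertices coincide.
\<close>

definition reflexive_arcs :: "'a set \<Rightarrow> ('a \<Rightarrow> 'a \<Rightarrow> bool) \<Rightarrow> 'a rel" where
  "reflexive_arcs V E = {(x, y). x \<in> V \<and> y \<in> V \<and> (x = y \<or> E x y)}"

lemma relation_digraph_simps [simp]:
  "verts (relation_digraph V E) = V"
  "(x, y) \<in> arcs (relation_digraph V E) \<longleftrightarrow> x \<in> V \<and> y \<in> V \<and> x \<noteq> y \<and> E x y"
  "tail (relation_digraph V E) = fst"
  "head (relation_digraph V E) = snd"
  by (simp_all add: relation_digraph_def)

lemma wf_relation_digraph: "wf_digraph (relation_digraph V E)"
  by unfold_locales auto

lemma refl_relpow_reflexive_arcs: "v \<in> V \<Longrightarrow> (v, v) \<in> reflexive_arcs V E ^^ k"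
proof (induction k)
  case (Suc k)
  then show ?case
    by (intro relpow_Suc_I[of v v]) (auto simp: reflexive_arcs_def)
qed auto

lemma awalk_imp_relpow:
  assumes "pre_digraph.awalk (relation_digraph V E) u p v"
  shows "(u, v) \<in> reflexive_arcs V E ^^ length p"
proof -
  interpret wf_digraph "relation_digraph V E" by (rule wf_relation_digraph)
  show ?thesis using assms
  proof (induction p arbitrary: u)
    case (Cons e p)
    then have "(u, snd e) \<in> reflexive_arcs V E" "awalk (snd e) p v"
      by (cases e; auto simp: awalk_Cons_iff reflexive_arcs_def)+
    with Cons.IH show ?case by (metis length_Cons relpow_Suc_I2)
  qed (auto simp: awalk_Nil_iff)
qed

lemma relpow_imp_awalk:
  assumes "(u, v) \<in> reflexive_arcs V E ^^ k" "v \<in> V"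
  shows "\<exists>p. pre_digraph.awalk (relation_digraph V E) u p v \<and> length p \<le> k"
proof -
  interpret wf_digraph "relation_digraph V E" by (rule wf_relation_digraph)
  show ?thesis using assms
  proof (induction k arbitrary: u)
    case 0
    then have "awalk u [] v" by (auto simp: awalk_Nil_iff)
    then show ?case by (intro exI[of _ "[]"]) simp
  next
    case (Suc k)
    then obtain w where w: "(u, w) \<in> reflexive_arcs V E" "(w, v) \<in> reflexive_arcs V E ^^ k"
      by (metis relpow_Suc_D2)
    with Suc obtain p where p: "awalk w p v" "length p \<le> k" by blast
    show ?case
    proof (cases "u = w")
      case True
      with p show ?thesis by (auto intro: le_SucI)
    next
      case False
      with w p have "awalk u ((u, w) # p) v"
        by (auto simp: awalk_Cons_iff reflexive_arcs_def)
      with p show ?thesis by (intro exI[of _ "(u, w) # p"]) simp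
    qed
  qed
qed

lemma (in wf_digraph) awalk_imp_short_apath:
  assumes "awalk u p v"
  shows "\<exists>q. apath u q v \<and> length q \<le> length p"
  using assms
proof (induction rule: awalk_to_apath_induct)
  case (decomp p q r s)
  then have "p = q @ r @ s"
    by (auto elim: awalk_cyc_decompE)
  with decomp show ?case by auto
qed (auto simp: apath_def)

text \<open>
  An infimum in the extended naturals is attained when it is finite, so a distance at most \<open>k\<close> is
  witnessed by a path; conversely, cutting the cycles out of a walk does not lengthen it.
\<close>

lemma digraph_dist_le_iff:
  assumes "u \<in> V" "v \<in> V"
  shows "digraph_dist (relation_digraph V E) u v \<le> enat k
    \<longleftrightarrow> (u, v) \<in> reflexive_arcs V E ^^ k"
proof -
  interpret wf_digraph "relation_digraph V E" by (rule wf_relation_digraph)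
  have "digraph_dist (relation_digraph V E) u v \<le> enat k
      \<longleftrightarrow> (\<exists>p. apath u p v \<and> length p \<le> k)"
  proof
    assume le: "digraph_dist (relation_digraph V E) u v \<le> enat k"
    show "\<exists>p. apath u p v \<and> length p \<le> k"
    proof (rule ccontr)
      assume "\<not> (\<exists>p. apath u p v \<and> length p \<le> k)"
      then have "enat (Suc k) \<le> digraph_dist (relation_digraph V E) u v"
        unfolding digraph_dist_def by (intro INF_greatest) (auto simp: not_le Suc_le_eq)
      from this le have "enat (Suc k) \<le> enat k" by (rule order_trans)
      then show False by simp
    qed
  next
    assume "\<exists>p. apath u p v \<and> length p \<le> k"
    then obtain p where "apath u p v" "enat (length p) \<le> enat k" by auto
    then show "digraph_dist (relation_digraph V E) u v \<le> enat k"
      unfolding digraph_dist_def by (auto intro: INF_lower2)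
  qed
  also have "\<dots> \<longleftrightarrow> (u, v) \<in> reflexive_arcs V E ^^ k"
  proof
    assume "\<exists>p. apath u p v \<and> length p \<le> k"
    then obtain p where p: "awalk u p v" "length p \<le> k" by (auto simp: apath_def)
    have "(u, v) \<in> reflexive_arcs V E ^^ length p O reflexive_arcs V E ^^ (k - length p)"
      using awalk_imp_relpow[OF p(1)] refl_relpow_reflexive_arcs[OF \<open>v \<in> V\<close>] by blast
    with p(2) show "(u, v) \<in> reflexive_arcs V E ^^ k"
      by (simp flip: relpow_add)
  next
    assume "(u, v) \<in> reflexive_arcs V E ^^ k"
    then show "\<exists>p. apath u p v \<and> length p \<le> k"
      using relpow_imp_awalk[OF _ \<open>v \<in> V\<close>] awalk_imp_short_apath by (meson order_trans)
  qed
  finally show ?thesis .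
qed

lemma digraph_diameter_le_iff:
  "digraph_diameter (relation_digraph V E) \<le> enat k \<longleftrightarrow> V \<times> V \<subseteq> reflexive_arcs V E ^^ k"
proof -
  have "digraph_diameter (relation_digraph V E) \<le> enat k
      \<longleftrightarrow> (\<forall>u\<in>V. \<forall>v\<in>V. u \<noteq> v \<longrightarrow> (u, v) \<in> reflexive_arcs V E ^^ k)"
    unfolding digraph_diameter_def
    by (auto simp: SUP_le_iff digraph_dist_le_iff)
  also have "\<dots> \<longleftrightarrow> (\<forall>u\<in>V. \<forall>v\<in>V. (u, v) \<in> reflexive_arcs V E ^^ k)"
    by (metis refl_relpow_reflexive_arcs)
  finally show ?thesis by auto
qed

lemma zero_divisor_digraph_eq:
  "zero_divisor_digraph R
    = relation_digraph (nonzero_zero_divisors R) (\<lambda>x y. x \<otimes>\<^bsub>R\<^esub> y = \<zero>\<^bsub>R\<^esub>)"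
  by (simp add: zero_divisor_digraph_def relation_digraph_def)

lemma zero_divisor_graph_eq:
  "zero_divisor_graph R = relation_digraph (nonzero_zero_divisors R)
    (\<lambda>x y. x \<otimes>\<^bsub>R\<^esub> y = \<zero>\<^bsub>R\<^esub> \<or> y \<otimes>\<^bsub>R\<^esub> x = \<zero>\<^bsub>R\<^esub>)"
  by (simp add: zero_divisor_graph_def relation_digraph_def)

lemma relpow_monotone: "(A :: 'a rel) \<subseteq> B \<Longrightarrow> A ^^ k \<subseteq> B ^^ k"
  by (induction k) (auto intro: relcomp_mono)

lemma diameter_graph_le_digraph:
  "digraph_diameter (zero_divisor_graph R) \<le> digraph_diameter (zero_divisor_digraph R)"
proof (cases "digraph_diameter (zero_divisor_digraph R)")
  case (enat k)
  let ?V = "nonzero_zero_divisors R"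
  have "reflexive_arcs ?V (\<lambda>x y. x \<otimes>\<^bsub>R\<^esub> y = \<zero>\<^bsub>R\<^esub>) ^^ k
      \<subseteq> reflexive_arcs ?V (\<lambda>x y. x \<otimes>\<^bsub>R\<^esub> y = \<zero>\<^bsub>R\<^esub> \<or> y \<otimes>\<^bsub>R\<^esub> x = \<zero>\<^bsub>R\<^esub>) ^^ k"
    by (rule relpow_monotone) (auto simp: reflexive_arcs_def)
  moreover have "?V \<times> ?V \<subseteq> reflexive_arcs ?V (\<lambda>x y. x \<otimes>\<^bsub>R\<^esub> y = \<zero>\<^bsub>R\<^esub>) ^^ k"
    using enat by (simp add: zero_divisor_digraph_eq flip: digraph_diameter_le_iff)
  ultimately show ?thesis
    unfolding enat zero_divisor_graph_eq digraph_diameter_le_iff by (rule order_trans[rotated])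
qed simp

section \<open>Finite rings\<close>

text \<open>
  If nothing nonzero killed \<open>x\<close> from the left, right multiplication by \<open>x\<close> would be injective, hence
  surjective by finiteness; a left inverse of \<open>x\<close> would follow, and it would kill \<open>y\<close>.
\<close>

lemma (in ring) finite_left_annihilator:
  assumes "finite (carrier R)" "x \<in> carrier R" "y \<in> carrier R" "y \<noteq> \<zero>" "x \<otimes> y = \<zero>"
  shows "\<exists>z\<in>carrier R. z \<noteq> \<zero> \<and> z \<otimes> x = \<zero>"
proof (rule ccontr)
  assume none: "\<not> ?thesis"
  have "inj_on (\<lambda>z. z \<otimes> x) (carrier R)"
  proof (rule inj_onI)
    fix a b assume ab: "a \<in> carrier R" "b \<in> carrier R" "a \<otimes> x = b \<otimes> x"
    then have "(a \<ominus> b) \<otimes> x = \<zero>"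
      using assms by (simp add: minus_eq l_distr l_minus r_neg)
    with none ab show "a = b" by (metis minus_closed r_right_minus_eq)
  qed
  then have "(\<lambda>z. z \<otimes> x) ` carrier R = carrier R"
    using assms by (intro endo_inj_surj) auto
  then obtain z where "z \<in> carrier R" "z \<otimes> x = \<one>"
    by (metis (no_types, lifting) imageE one_closed)
  then have "y = z \<otimes> (x \<otimes> y)"
    using assms m_assoc[of z x y] by simp
  with assms \<open>z \<in> carrier R\<close> show False by simp
qed

lemma (in ring) finite_right_annihilator:
  assumes "finite (carrier R)" "x \<in> carrier R" "y \<in> carrier R" "y \<noteq> \<zero>" "y \<otimes> x = \<zero>"
  shows "\<exists>z\<in>carrier R. z \<noteq> \<zero> \<and> x \<otimes> z = \<zero>"
proof (rule ccontr)
  assume none: "\<not> ?thesis"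
  have "inj_on (\<lambda>z. x \<otimes> z) (carrier R)"
  proof (rule inj_onI)
    fix a b assume ab: "a \<in> carrier R" "b \<in> carrier R" "x \<otimes> a = x \<otimes> b"
    then have "x \<otimes> (a \<ominus> b) = \<zero>"
      using assms by (simp add: minus_eq r_distr r_minus r_neg)
    with none ab show "a = b" by (metis minus_closed r_right_minus_eq)
  qed
  then have "(\<lambda>z. x \<otimes> z) ` carrier R = carrier R"
    using assms by (intro endo_inj_surj) auto
  then obtain z where "z \<in> carrier R" "x \<otimes> z = \<one>"
    by (metis (no_types, lifting) imageE one_closed)
  then have "y = (y \<otimes> x) \<otimes> z"
    using assms m_assoc[of y x z] by simp
  with assms \<open>z \<in> carrier R\<close> show False by simp
qed

text \<open>
  If \<open>u c = 0\<close> and \<open>d v = 0\<close>, the product \<open>c d\<close> lies between \<open>u\<close> and \<open>v\<close>; when it is zero, \<open>c\<close> and \<open>d\<close> themselves are linked.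
\<close>

lemma (in ring) diameter_zero_divisor_digraph_le_3:
  assumes fin: "finite (carrier R)"
  shows "digraph_diameter (zero_divisor_digraph R) \<le> 3"
proof -
  define V where "V = nonzero_zero_divisors R"
  define S where "S = reflexive_arcs V (\<lambda>x y. x \<otimes> y = \<zero>)"
  have "(u, v) \<in> S ^^ 3" if uv: "u \<in> V" "v \<in> V" for u v
  proof -
    have carr: "u \<in> carrier R" "v \<in> carrier R" and nz: "u \<noteq> \<zero>" "v \<noteq> \<zero>"
      using uv by (auto simp: V_def nonzero_zero_divisors_def)
    obtain c where c: "c \<in> carrier R" "c \<noteq> \<zero>" "u \<otimes> c = \<zero>"
      using uv finite_right_annihilator[OF fin]
      unfolding V_def nonzero_zero_divisors_def by blast
    obtain d where d: "d \<in> carrier R" "d \<noteq> \<zero>" "d \<otimes> v = \<zero>"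
      using uv finite_left_annihilator[OF fin]
      unfolding V_def nonzero_zero_divisors_def by blast
    have cd: "c \<in> V" "d \<in> V"
      using carr nz c d by (auto simp: V_def nonzero_zero_divisors_def)
    show ?thesis
    proof (cases "c \<otimes> d = \<zero>")
      case True
      then have "(u, c) \<in> S" "(c, d) \<in> S" "(d, v) \<in> S"
        using uv c d cd by (auto simp: S_def reflexive_arcs_def)
      then show ?thesis by (auto simp: numeral_3_eq_3)
    next
      case False
      have *: "u \<otimes> (c \<otimes> d) = \<zero>" "(c \<otimes> d) \<otimes> v = \<zero>"
        using c d carr by (simp_all add: m_assoc flip: m_assoc[of u])
      then have "c \<otimes> d \<in> V"
        using False c d carr nz by (auto simp: V_def nonzero_zero_divisors_def)
      with * have "(u, c \<otimes> d) \<in> S" "(c \<otimes> d, v) \<in> S" "(v, v) \<in> S"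
        using uv by (auto simp: S_def reflexive_arcs_def)
      then show ?thesis by (auto simp: numeral_3_eq_3)
    qed
  qed
  then show ?thesis
    unfolding zero_divisor_digraph_eq numeral_eq_enat digraph_diameter_le_iff S_def V_def
    by auto
qed

section \<open>Integer quaternions\<close>

text \<open>
  Products modulo \<open>n\<close> are computed with integer representatives: equations in the residue ring become
  divisibility statements about integer quaternions, and one representative can be viewed modulo
  \<open>n\<close>, modulo a prime and modulo a cofactor at the same time.
\<close>

type_synonym quat = "int \<times> int \<times> int \<times> int"

fun qmul :: "quat \<Rightarrow> quat \<Rightarrow> quat" where
  "qmul (a, b, c, d) (a', b', c', d') =
    (a * a' - b * b' - c * c' - d * d', a * b' + b * a' + c * d' - d * c',
     a * c' - b * d' + c * a' + d * b', a * d' + b * c' - c * b' + d * a')"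

fun qcnj :: "quat \<Rightarrow> quat" where
  "qcnj (a, b, c, d) = (a, - b, - c, - d)"

fun qnorm :: "quat \<Rightarrow> int" where
  "qnorm (a, b, c, d) = a\<^sup>2 + b\<^sup>2 + c\<^sup>2 + d\<^sup>2"

fun qscale :: "int \<Rightarrow> quat \<Rightarrow> quat" where
  "qscale k (a, b, c, d) = (k * a, k * b, k * c, k * d)"

fun qdvd :: "int \<Rightarrow> quat \<Rightarrow> bool" where
  "qdvd m (a, b, c, d) \<longleftrightarrow> m dvd a \<and> m dvd b \<and> m dvd c \<and> m dvd d"

fun qmod :: "int \<Rightarrow> quat \<Rightarrow> quat" where
  "qmod m (a, b, c, d) = (a mod m, b mod m, c mod m, d mod m)"

lemma qmul_assoc: "qmul (qmul x y) z = qmul x (qmul y z)"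
  by (cases x rule: prod_cases4; cases y rule: prod_cases4; cases z rule: prod_cases4)
    (simp add: algebra_simps)

lemma qmul_qscale:
  "qmul x (qscale k y) = qscale k (qmul x y)" "qmul (qscale k x) y = qscale k (qmul x y)"
  by (cases x rule: prod_cases4; cases y rule: prod_cases4; simp add: algebra_simps)+

lemma qcnj_qmul_cancel:
  "qmul (qcnj x) (qmul x y) = qscale (qnorm x) y" "qmul (qmul y x) (qcnj x) = qscale (qnorm x) y"
  "qmul x (qmul (qcnj x) y) = qscale (qnorm x) y" "qmul (qmul y (qcnj x)) x = qscale (qnorm x) y"
  by (cases x rule: prod_cases4; cases y rule: prod_cases4;
      simp add: algebra_simps power2_eq_square)+

lemma qdvd_qmul: "qdvd m x \<Longrightarrow> qdvd m (qmul x y)" "qdvd m y \<Longrightarrow> qdvd m (qmul x y)"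
  by (cases x rule: prod_cases4; cases y rule: prod_cases4; auto)+

lemma qdvd_qscale: "m dvd k \<Longrightarrow> qdvd m (qscale k x)" "qdvd m x \<Longrightarrow> qdvd m (qscale k x)"
  by (cases x rule: prod_cases4; auto)+

lemma qdvd_mult_qscale:
  assumes "k \<noteq> 0"
  shows "qdvd (k * m) (qscale k x) \<longleftrightarrow> qdvd m x"
  using assms by (cases x rule: prod_cases4) auto

lemma coprime_qdvd_qscale: "coprime m k \<Longrightarrow> qdvd m (qscale k x) \<longleftrightarrow> qdvd m x"
  by (cases x rule: prod_cases4) (auto simp: coprime_dvd_mult_right_iff)

lemma qdvd_trans: "m dvd n \<Longrightarrow> qdvd n x \<Longrightarrow> qdvd m x"
  by (cases x rule: prod_cases4) (auto intro: dvd_trans)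

lemma qdvd_coprime_mult: "coprime m k \<Longrightarrow> qdvd m x \<Longrightarrow> qdvd k x \<Longrightarrow> qdvd (m * k) x"
  by (cases x rule: prod_cases4) (auto intro: divides_mult)

text \<open>
  Multiplying by the conjugate turns the factor \<open>x\<close> into its norm, a unit modulo \<open>m\<close>.
\<close>

lemma coprime_norm_cancel:
  assumes "coprime m (qnorm x)" "qdvd m (qmul x y) \<or> qdvd m (qmul y x)"
  shows "qdvd m y"
  using assms(2)
proof
  assume "qdvd m (qmul x y)"
  then have "qdvd m (qmul (qcnj x) (qmul x y))" by (rule qdvd_qmul)
  with assms(1) show ?thesis by (simp add: qcnj_qmul_cancel coprime_qdvd_qscale)
next
  assume "qdvd m (qmul y x)"
  then have "qdvd m (qmul (qmul y x) (qcnj x))" by (rule qdvd_qmul)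
  with assms(1) show ?thesis by (simp add: qcnj_qmul_cancel coprime_qdvd_qscale)
qed

section \<open>Quaternions modulo a prime\<close>

text \<open>
  This rests on the identity \<open>x - i x i - j x j - k x k = 4 Re x\<close>, multiplied by \<open>y\<close> from the right.
\<close>

lemma real_part_annihilates:
  fixes a b c d a' b' c' d' :: int
  assumes "\<And>q. qdvd m (qmul (a, b, c, d) (qmul q (a', b', c', d')))"
  shows "qdvd m (qscale (4 * a) (a', b', c', d'))"
proof -
  define f where "f u = qmul u (qmul (a, b, c, d) (qmul u (a', b', c', d')))" for u
  have *: "qdvd m (f u)" for u
    unfolding f_def by (intro qdvd_qmul(2) assms)
  have sum: "qdvd m (x0 - x1 - x2 - x3, y0 - y1 - y2 - y3, z0 - z1 - z2 - z3, w0 - w1 - w2 - w3)"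
    if "qdvd m (x0, y0, z0, w0)" "qdvd m (x1, y1, z1, w1)" "qdvd m (x2, y2, z2, w2)"
      "qdvd m (x3, y3, z3, w3)" for x0 y0 z0 w0 x1 y1 z1 w1 x2 y2 z2 w2 x3 y3 z3 w3
    using that by auto
  from sum[OF *[of "(1, 0, 0, 0)", unfolded f_def, simplified qmul.simps]
      *[of "(0, 1, 0, 0)", unfolded f_def, simplified qmul.simps]
      *[of "(0, 0, 1, 0)", unfolded f_def, simplified qmul.simps]
      *[of "(0, 0, 0, 1)", unfolded f_def, simplified qmul.simps]]
  show ?thesis by (simp add: algebra_simps)
qed

text \<open>
  The two-sided ideal generated by \<open>x\<close> contains four times each coordinate of \<open>x\<close>: up to sign, the
  coordinates are the real parts of \<open>x\<close>, \<open>i x\<close>, \<open>j x\<close> and \<open>k x\<close>. For odd \<open>p\<close> one of these scalars is a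
  unit modulo \<open>p\<close> unless \<open>x\<close> vanishes, and then \<open>y\<close> has to vanish. For \<open>p = 2\<close> the claim fails, for
  instance for \<open>x = y = 1 + i\<close>.
\<close>

lemma odd_prime_quaternions_prime:
  fixes p :: int
  assumes p: "prime p" "p \<noteq> 2"
    and all: "\<And>q. qdvd p (qmul x (qmul q y))"
  shows "qdvd p x \<or> qdvd p y"
proof (rule ccontr)
  assume "\<not> ?thesis"
  then have nx: "\<not> qdvd p x" and ny: "\<not> qdvd p y" by auto
  obtain a' b' c' d' where y: "y = (a', b', c', d')" by (rule prod_cases4)
  have not4: "\<not> p dvd 4"
  proof
    assume "p dvd 4"
    then have "p dvd 2 * 2" by simp
    with p show False
      by (metis prime_dvd_mult_iff primes_dvd_imp_eq two_is_prime_nat prime_int_numeral_eq)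
  qed
  have real_part: "p dvd fst (qmul u x)" for u
  proof -
    obtain a b c d where ux: "qmul u x = (a, b, c, d)" by (rule prod_cases4)
    have "qdvd p (qmul (a, b, c, d) (qmul q y))" for q
      unfolding ux[symmetric] qmul_assoc by (intro qdvd_qmul(2) all)
    then have "qdvd p (qscale (4 * a) y)"
      unfolding y by (rule real_part_annihilates)
    then have "p dvd 4 * a"
      using ny p(1) unfolding y by (auto simp: prime_dvd_mult_iff)
    then show ?thesis using p(1) not4 ux by (simp add: prime_dvd_mult_iff)
  qed
  obtain a b c d where x: "x = (a, b, c, d)" by (rule prod_cases4)
  have "p dvd a" "p dvd - b" "p dvd - c" "p dvd - d"
    using real_part[of "(1, 0, 0, 0)"] real_part[of "(0, 1, 0, 0)"]
      real_part[of "(0, 0, 1, 0)"] real_part[of "(0, 0, 0, 1)"] by (auto simp: x)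
  with nx show False by (simp add: x)
qed

text \<open>
  Every \<open>x\<^sup>* q y\<^sup>*\<close> is killed by \<open>x\<close> from the left and by \<open>y\<close> from the right, because the norms
  vanish modulo \<open>p\<close>; for odd \<open>p\<close>, primeness of the ring provides a nonzero one when \<open>x\<close> and \<open>y\<close>
  are nonzero.
\<close>

lemma exists_common_annihilator_mod_prime:
  fixes p :: int
  assumes p: "prime p" and nx: "p dvd qnorm x" and ny: "p dvd qnorm y"
  shows "\<exists>c. \<not> qdvd p c \<and> qdvd p (qmul x c) \<and> qdvd p (qmul c y)"
proof (cases "p = 2")
  case True
  \<comment> \<open>Modulo 2 every product with \<open>1 + i + j + k\<close> is a multiple of the coordinate sum, which has the
    parity of the norm.\<close>
  with nx ny show ?thesis
    by (cases x rule: prod_cases4; cases y rule: prod_cases4; intro exI[of _ "(1, 1, 1, 1)"])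
      (auto simp: even_add even_diff)
next
  case False
  have [simp]: "qdvd p (qcnj z) \<longleftrightarrow> qdvd p z" for z
    by (cases z rule: prod_cases4) simp
  have one: "\<not> qdvd p (1, 0, 0, 0)"
    using p by (auto simp: not_prime_unit)
  have mul_one: "qmul z (1, 0, 0, 0) = z" "qmul (1, 0, 0, 0) z = z" for z
    by (cases z rule: prod_cases4; simp)+
  have l: "qdvd p (qmul x (qmul (qcnj x) q))" for q
    using nx by (simp add: qcnj_qmul_cancel qdvd_qscale)
  have r: "qdvd p (qmul (qmul q (qcnj y)) y)" for q
    using ny by (simp add: qcnj_qmul_cancel qdvd_qscale)
  show ?thesis
  proof (cases "qdvd p x \<or> qdvd p y")
    case zero: True
    show ?thesis
    proof (cases "qdvd p x \<and> qdvd p y")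
      case True
      with one show ?thesis by (intro exI[of _ "(1, 0, 0, 0)"]) (auto intro: qdvd_qmul)
    next
      case False
      then show ?thesis
        using zero l[of "(1, 0, 0, 0)"] r[of "(1, 0, 0, 0)"] qdvd_qmul
        unfolding mul_one by (metis \<open>\<And>z. qdvd p (qcnj z) = qdvd p z\<close>)
    qed
  next
    case nonzero: False
    then obtain q where "\<not> qdvd p (qmul (qcnj x) (qmul q (qcnj y)))"
      using odd_prime_quaternions_prime[OF p False, of "qcnj x" "qcnj y"] by auto
    then show ?thesis
      using l r by (intro exI[of _ "qmul (qcnj x) (qmul q (qcnj y))"]) (metis qmul_assoc)
  qed
qed

text \<open>
  For \<open>p = 2 h + 1\<close> the squares and the numbers \<open>- 1 - y\<^sup>2\<close> each take \<open>h + 1\<close> values modulo \<open>p\<close>; these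
  are too many for two disjoint sets of residues.
\<close>

lemma prime_dvd_one_plus_two_squares:
  fixes p :: int
  assumes p: "prime p"
  shows "\<exists>r s. p dvd 1 + r\<^sup>2 + s\<^sup>2"
proof (cases "p = 2")
  case True
  then show ?thesis by (intro exI[of _ 1] exI[of _ 0]) simp
next
  case False
  have "p > 1" using p prime_gt_1_int by blast
  have "odd p" using p False by (metis prime_odd_int prime_ge_2_int order_le_less)
  then obtain h where h: "p = 2 * h + 1" by (elim oddE)
  with \<open>p > 1\<close> have "h \<ge> 0" by simp
  have inj: "x = y" if "x \<in> {0..h}" "y \<in> {0..h}" "p dvd x\<^sup>2 - y\<^sup>2" for x y
  proof -
    have "p dvd (x - y) * (x + y)" using that(3) by (simp add: power2_eq_square algebra_simps)
    then consider "p dvd x - y" | "p dvd x + y" using p by (auto simp: prime_dvd_mult_iff)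
    then show ?thesis
    proof cases
      case 1
      with that(1,2) h show ?thesis
        using dvd_imp_le_int[of "x - y" p] by (cases "x = y") auto
    next
      case 2
      with that(1,2) h show ?thesis
        using dvd_imp_le_int[of "x + y" p] by (cases "x = y") auto
    qed
  qed
  define A where "A = (\<lambda>x. x\<^sup>2 mod p) ` {0..h}"
  define B where "B = (\<lambda>y. (- 1 - y\<^sup>2) mod p) ` {0..h}"
  have "inj_on (\<lambda>x. x\<^sup>2 mod p) {0..h}"
    by (rule inj_onI) (auto intro: inj simp: mod_eq_dvd_iff)
  then have cA: "card A = nat (h + 1)" unfolding A_def by (simp add: card_image)
  have "inj_on (\<lambda>y. (- 1 - y\<^sup>2) mod p) {0..h}"
    by (rule inj_onI) (auto intro!: inj[symmetric] simp: mod_eq_dvd_iff)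
  then have cB: "card B = nat (h + 1)" unfolding B_def by (simp add: card_image)
  have "A \<inter> B \<noteq> {}"
  proof
    assume "A \<inter> B = {}"
    then have "card (A \<union> B) = card A + card B"
      by (intro card_Un_disjoint) (auto simp: A_def B_def)
    moreover have "A \<union> B \<subseteq> {0..<p}" using \<open>p > 1\<close> by (auto simp: A_def B_def)
    then have "card (A \<union> B) \<le> nat p" using card_mono[of "{0..<p}"] by fastforce
    ultimately show False using cA cB h \<open>h \<ge> 0\<close> by simp
  qed
  then obtain r s where "r\<^sup>2 mod p = (- 1 - s\<^sup>2) mod p" by (auto simp: A_def B_def)
  then have "p dvd 1 + r\<^sup>2 + s\<^sup>2" by (simp add: mod_eq_dvd_iff algebra_simps)
  then show ?thesis by blast
qed

lemma prime_dvd_one_plus_two_squares_multiples: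
  fixes p k :: int
  assumes p: "prime p" and "coprime p k"
  shows "\<exists>r s. k dvd r \<and> k dvd s \<and> p dvd 1 + r\<^sup>2 + s\<^sup>2"
proof -
  obtain r s where rs: "p dvd 1 + r\<^sup>2 + s\<^sup>2"
    using prime_dvd_one_plus_two_squares[OF p] by blast
  obtain t where t: "[k * t = 1] (mod p)"
    using \<open>coprime p k\<close> cong_solve_coprime_int[of k p] by (auto simp: coprime_commute)
  have "[1 + (k * t * r)\<^sup>2 + (k * t * s)\<^sup>2 = 1 + (1 * r)\<^sup>2 + (1 * s)\<^sup>2] (mod p)"
    by (intro cong_add cong_pow cong_mult t cong_refl)
  with rs have "p dvd 1 + (k * t * r)\<^sup>2 + (k * t * s)\<^sup>2"
    by (simp add: cong_dvd_iff)
  then show ?thesis by (intro exI[of _ "k * t * r"] exI[of _ "k * t * s"]) (simp add: mult.assoc)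
qed

section \<open>Zero divisors among the quaternions modulo n\<close>

context
  fixes n :: nat
  assumes n: "n > 1"
begin

lemma quaternions_mod_ring: "ring (quaternions_mod n)"
  and quaternions_mod_finite: "finite (carrier (quaternions_mod n))"
  and quaternions_mod_mult: "x \<otimes>\<^bsub>quaternions_mod n\<^esub> y = qmod (int n) (qmul x y)"
  and quaternions_mod_zero: "\<zero>\<^bsub>quaternions_mod n\<^esub> = (0, 0, 0, 0)"
  and qmod_closed: "qmod (int n) x \<in> carrier (quaternions_mod n)"
  and qmod_carrier: "x \<in> carrier (quaternions_mod n) \<Longrightarrow> qmod (int n) x = x"
proof -
  interpret residues "int n" "residue_ring (int n)"
    by unfold_locales (use n in simp_all)
  show "ring (quaternions_mod n)"
    unfolding quaternions_mod_def by (rule quaternion_ring_is_ring)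
  show "finite (carrier (quaternions_mod n))"
    unfolding quaternions_mod_def quaternion_ring_def by simp
  show "x \<otimes>\<^bsub>quaternions_mod n\<^esub> y = qmod (int n) (qmul x y)"
    by (cases x rule: prod_cases4; cases y rule: prod_cases4)
      (simp add: quaternions_mod_def quaternion_ring_def a_minus_def res_neg_eq res_add_eq
        res_mult_eq mod_simps)
  show "\<zero>\<^bsub>quaternions_mod n\<^esub> = (0, 0, 0, 0)"
    by (simp add: quaternions_mod_def quaternion_ring_def res_zero_eq)
  show "qmod (int n) x \<in> carrier (quaternions_mod n)"
    using n by (cases x rule: prod_cases4)
      (simp add: quaternions_mod_def quaternion_ring_def res_carrier_eq)
  show "x \<in> carrier (quaternions_mod n) \<Longrightarrow> qmod (int n) x = x"
    by (cases x rule: prod_cases4)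
      (simp add: quaternions_mod_def quaternion_ring_def res_carrier_eq)
qed

lemma qmod_eq_zero_iff: "qmod (int n) x = (0, 0, 0, 0) \<longleftrightarrow> qdvd (int n) x"
  by (cases x rule: prod_cases4) (auto simp: mod_eq_0_iff_dvd)

lemma qdvd_qmul_qmod:
  "qdvd (int n) (qmul (qmod (int n) x) y) \<longleftrightarrow> qdvd (int n) (qmul x y)"
  "qdvd (int n) (qmul x (qmod (int n) y)) \<longleftrightarrow> qdvd (int n) (qmul x y)"
  by (cases x rule: prod_cases4; cases y rule: prod_cases4;
      simp only: qmod.simps qmul.simps qdvd.simps;
      intro conj_cong cong_dvd_iff cong_add cong_diff cong_mult cong_refl; simp add: cong_def)+

lemma quaternions_mod_mult_eq_zero:
  "x \<otimes>\<^bsub>quaternions_mod n\<^esub> y = \<zero>\<^bsub>quaternions_mod n\<^esub> \<longleftrightarrow> qdvd (int n) (qmul x y)"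
  by (simp add: quaternions_mod_mult quaternions_mod_zero qmod_eq_zero_iff)

lemma quaternions_mod_vertexD:
  assumes "x \<in> nonzero_zero_divisors (quaternions_mod n)"
  shows "qmod (int n) x = x" "\<not> qdvd (int n) x"
    "\<exists>y. \<not> qdvd (int n) y \<and> (qdvd (int n) (qmul x y) \<or> qdvd (int n) (qmul y x))"
proof -
  have eq: "z = \<zero>\<^bsub>quaternions_mod n\<^esub> \<longleftrightarrow> qdvd (int n) z" if "z \<in> carrier (quaternions_mod n)" for z
    using qmod_eq_zero_iff[of z] qmod_carrier[OF that] quaternions_mod_zero by simp
  have x: "x \<in> carrier (quaternions_mod n)" "x \<noteq> \<zero>\<^bsub>quaternions_mod n\<^esub>"
    using assms by (simp_all add: nonzero_zero_divisors_def)
  then show "qmod (int n) x = x" "\<not> qdvd (int n) x"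
    by (simp_all add: qmod_carrier eq)
  obtain y where y: "y \<in> carrier (quaternions_mod n)" "y \<noteq> \<zero>\<^bsub>quaternions_mod n\<^esub>"
    "qdvd (int n) (qmul x y) \<or> qdvd (int n) (qmul y x)"
    using assms by (auto simp: nonzero_zero_divisors_def quaternions_mod_mult_eq_zero)
  have "\<not> qdvd (int n) y" using y(2) by (simp only: eq[OF y(1)] not_False_eq_True)
  with y(3) show "\<exists>y. \<not> qdvd (int n) y \<and> (qdvd (int n) (qmul x y) \<or> qdvd (int n) (qmul y x))"
    by (intro exI[of _ y] conjI)
qed

lemma qmod_vertexI:
  assumes "\<not> qdvd (int n) x" "\<not> qdvd (int n) y"
    "qdvd (int n) (qmul x y) \<or> qdvd (int n) (qmul y x)"
  shows "qmod (int n) x \<in> nonzero_zero_divisors (quaternions_mod n)"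
proof -
  have "qmod (int n) x \<noteq> \<zero>\<^bsub>quaternions_mod n\<^esub>"
    "qmod (int n) y \<noteq> \<zero>\<^bsub>quaternions_mod n\<^esub>"
    using assms(1,2) by (simp_all add: quaternions_mod_zero qmod_eq_zero_iff)
  moreover have "qmod (int n) x \<otimes>\<^bsub>quaternions_mod n\<^esub> qmod (int n) y = \<zero>\<^bsub>quaternions_mod n\<^esub> \<or>
      qmod (int n) y \<otimes>\<^bsub>quaternions_mod n\<^esub> qmod (int n) x = \<zero>\<^bsub>quaternions_mod n\<^esub>"
    using assms(3) by (simp only: quaternions_mod_mult_eq_zero qdvd_qmul_qmod)
  ultimately show ?thesis
    unfolding nonzero_zero_divisors_def mem_Collect_eq
    by (intro conjI bexI[of _ "qmod (int n) y"] qmod_closed)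
qed

text \<open>
  The annihilator is the conjugate of \<open>x\<close> scaled by \<open>n / p\<close>. Requiring \<open>x\<close> to be nonzero modulo \<open>p\<close>,
  not just modulo \<open>n\<close>, keeps this annihilator nonzero.
\<close>

lemma norm_dvd_vertexI:
  assumes "prime p" "p dvd int n" "p dvd qnorm x" "\<not> qdvd p x"
  shows "qmod (int n) x \<in> nonzero_zero_divisors (quaternions_mod n)"
proof -
  obtain m where m: "int n = m * p" using \<open>p dvd int n\<close> by (metis dvd_div_mult_self)
  with n have "m \<noteq> 0" by auto
  have "qdvd p (qcnj x) \<longleftrightarrow> qdvd p x" by (cases x rule: prod_cases4) simp
  then have "\<not> qdvd (int n) (qscale m (qcnj x))"
    using assms(4) \<open>m \<noteq> 0\<close> by (simp add: m qdvd_mult_qscale)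
  moreover have "qmul x (qcnj x) = qscale (qnorm x) (1, 0, 0, 0)"
    by (cases x rule: prod_cases4) (simp add: power2_eq_square)
  then have "qdvd (int n) (qmul x (qscale m (qcnj x)))"
    using assms(3) \<open>m \<noteq> 0\<close> by (simp add: m qmul_qscale qdvd_mult_qscale qdvd_qscale)
  moreover have "\<not> qdvd (int n) x"
    using assms(2,4) qdvd_trans by blast
  ultimately show ?thesis by (intro qmod_vertexI) auto
qed

text \<open>
  A vertex has norm divisible by \<open>p\<close>, since otherwise it could be cancelled; a common annihilator
  modulo \<open>p\<close> becomes one modulo \<open>n\<close> on multiplication by \<open>p ^ e\<close>.
\<close>

lemma diameter_le_2_if_prime_power:
  assumes p: "prime p" and np: "n = p ^ Suc e"
  shows "digraph_diameter (zero_divisor_digraph (quaternions_mod n)) \<le> 2"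
proof -
  define V where "V = nonzero_zero_divisors (quaternions_mod n)"
  define S where
    "S = reflexive_arcs V (\<lambda>x y. x \<otimes>\<^bsub>quaternions_mod n\<^esub> y = \<zero>\<^bsub>quaternions_mod n\<^esub>)"
  have ip: "prime (int p)" and nm: "int n = int p ^ e * int p" and "int p ^ e \<noteq> 0"
    using p by (auto simp: np prime_gt_0_nat)
  have norm: "int p dvd qnorm x" if "x \<in> V" for x
  proof (rule ccontr)
    assume "\<not> ?thesis"
    with ip have "coprime (int n) (qnorm x)"
      by (simp add: np prime_imp_coprime del: power_Suc)
    with quaternions_mod_vertexD(3)[OF that[unfolded V_def]] coprime_norm_cancel show False
      by blast
  qed
  have "(x, y) \<in> S ^^ 2" if xy: "x \<in> V" "y \<in> V" for x y
  proof -
    obtain c where c: "\<not> qdvd (int p) c" "qdvd (int p) (qmul x c)" "qdvd (int p) (qmul c y)"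
      using exists_common_annihilator_mod_prime[OF ip norm norm] xy by blast
    define C where "C = qscale (int p ^ e) c"
    have C: "\<not> qdvd (int n) C" "qdvd (int n) (qmul x C)" "qdvd (int n) (qmul C y)"
      using c \<open>int p ^ e \<noteq> 0\<close> by (simp_all add: C_def nm qmul_qscale qdvd_mult_qscale)
    then have "qmod (int n) C \<in> V"
      unfolding V_def using quaternions_mod_vertexD(2)[OF xy(1)[unfolded V_def]]
      by (intro qmod_vertexI[of C x]) auto
    with xy C have "(x, qmod (int n) C) \<in> S" "(qmod (int n) C, y) \<in> S"
      by (auto simp: S_def reflexive_arcs_def quaternions_mod_mult_eq_zero qdvd_qmul_qmod)
    then show ?thesis by (auto simp: numeral_2_eq_2)
  qed
  then show ?thesis
    unfolding zero_divisor_digraph_eq numeral_eq_enat digraph_diameter_le_iff S_def V_def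
    by auto
qed

text \<open>
  Two distinct vertices whose products in both orders are nonzero already modulo \<open>p\<close>.
\<close>

lemma diameter_not_le_1_if_prime_power:
  assumes p: "prime p" and np: "n = p ^ Suc e"
  shows "\<not> digraph_diameter (zero_divisor_graph (quaternions_mod n)) \<le> 1"
proof -
  have ip: "prime (int p)" and pn: "int p dvd int n" using p by (auto simp: np)
  have "\<exists>x y. \<not> qdvd (int p) x \<and> \<not> qdvd (int p) y
    \<and> int p dvd qnorm x \<and> int p dvd qnorm y
    \<and> qmod (int n) x \<noteq> qmod (int n) y \<and> \<not> qdvd (int p) (qmul x y) \<and> \<not> qdvd (int p) (qmul y x)"
  proof (cases "p = 2")
    case True
    have "(1 :: int) mod int n = 1" using n by simp
    then have "qmod (int n) (1, 1, 0, 0) \<noteq> qmod (int n) (1, 0, 1, 0)" by auto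
    with True show ?thesis
      by (intro exI[of _ "(1, 1, 0, 0)"] exI[of _ "(1, 0, 1, 0)"]) auto
  next
    case False
    have not2: "\<not> int p dvd 2"
      using p False by (metis int_dvd_int_iff of_nat_numeral primes_dvd_imp_eq two_is_prime_nat)
    obtain r s where rs: "int p dvd 1 + r\<^sup>2 + s\<^sup>2"
      using prime_dvd_one_plus_two_squares[OF ip] by blast
    \<comment> \<open>the real part of the square of \<open>1 + r i + s j\<close>; it is congruent to 2 modulo \<open>p\<close>\<close>
    have "\<not> int p dvd 1 - r\<^sup>2 - s\<^sup>2"
      using not2 rs dvd_add[of "int p" "1 - r\<^sup>2 - s\<^sup>2" "1 + r\<^sup>2 + s\<^sup>2"] by auto
    then have "\<not> int p dvd r * r + s * s - 1"
      using dvd_minus_iff[of "int p" "r * r + s * s - 1"]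
      by (simp add: power2_eq_square algebra_simps)
    moreover have "\<not> 1 mod int n = - 1 mod int n"
      using not2 pn by (auto simp: mod_eq_dvd_iff intro: dvd_trans)
    ultimately show ?thesis
      using rs not2 ip
      by (intro exI[of _ "(1, r, s, 0)"] exI[of _ "(- 1, - r, - s, 0)"]) (auto simp: algebra_simps)
  qed
  then obtain x y where xy: "\<not> qdvd (int p) x" "\<not> qdvd (int p) y" "int p dvd qnorm x"
    "int p dvd qnorm y" "qmod (int n) x \<noteq> qmod (int n) y" "\<not> qdvd (int p) (qmul x y)"
    "\<not> qdvd (int p) (qmul y x)" by blast
  have "qmod (int n) x \<in> nonzero_zero_divisors (quaternions_mod n)"
    "qmod (int n) y \<in> nonzero_zero_divisors (quaternions_mod n)"
    using xy norm_dvd_vertexI[OF ip pn] by auto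
  moreover have "\<not> qdvd (int n) (qmul x y)" "\<not> qdvd (int n) (qmul y x)"
    using xy(6,7) qdvd_trans[OF pn] by blast+
  ultimately show ?thesis
    unfolding zero_divisor_graph_eq one_enat_def digraph_diameter_le_iff
    using xy(5) by (auto simp: reflexive_arcs_def quaternions_mod_mult_eq_zero qdvd_qmul_qmod)
qed

text \<open>
  In terms of the decomposition of the ring into its parts modulo \<open>p ^ e\<close> and modulo \<open>k\<close>, the element
  \<open>x\<close> is a zero divisor in the first part and 1 in the second, while the scalar \<open>k\<close> is a unit in the
  first part and 0 in the second. Annihilators of \<open>x\<close> live in the first part and those of \<open>k\<close> in the
  second, so no nonzero element is both.
\<close>

lemma diameter_not_le_2_if_not_prime_power:
  assumes "\<not> primepow n"
  shows "\<not> digraph_diameter (zero_divisor_graph (quaternions_mod n)) \<le> 2"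
proof -
  define V where "V = nonzero_zero_divisors (quaternions_mod n)"
  define S where "S = reflexive_arcs V
      (\<lambda>x y. x \<otimes>\<^bsub>quaternions_mod n\<^esub> y = \<zero>\<^bsub>quaternions_mod n\<^esub> \<or>
        y \<otimes>\<^bsub>quaternions_mod n\<^esub> x = \<zero>\<^bsub>quaternions_mod n\<^esub>)"
  obtain p where p: "prime p" "p dvd n" using n prime_factor_nat[of n] by auto
  obtain e k where k: "n = p ^ e * k" "\<not> p dvd k"
    by (rule multiplicity_decompose'[of n p]) (use n p in auto)
  have "e > 0" using k p by (cases e) auto
  then have "k \<noteq> 1" using assms p k unfolding primepow_def by (metis mult.right_neutral)
  moreover have "k \<noteq> 0" using k(2) by (metis dvd_0_right)
  ultimately have "k > 1" by simp
  have ip: "prime (int p)" and pn: "int p dvd int n" using p by simp_all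
  have kn: "int k dvd int n" using k(1) by simp
  have cop: "coprime (int p) (int k)"
    using ip k(2) by (simp add: prime_imp_coprime)
  have nm: "int n = int p ^ e * int k" using k by simp
  obtain r s where rs: "int k dvd r" "int k dvd s" "int p dvd 1 + r\<^sup>2 + s\<^sup>2"
    using prime_dvd_one_plus_two_squares_multiples[OF ip cop] by blast
  define x where "x = (1 :: int, r, s, 0 :: int)"
  define y where "y = qscale (int k) (1, 0, 0, 0)"
  have y_mul: "qmul y z = qscale (int k) z" "qmul z y = qscale (int k) z" for z
    by (cases z rule: prod_cases4; simp add: y_def)+
  have dvd_y: "qdvd (int n) (qscale (int k) z) \<longleftrightarrow> qdvd (int p ^ e) z" for z
    using \<open>k \<noteq> 0\<close> qdvd_mult_qscale[of "int k" "int p ^ e" z] by (simp add: nm mult.commute)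
  have norm_x: "coprime (int k) (qnorm x)"
  proof (rule coprimeI)
    fix c assume c: "c dvd int k" "c dvd qnorm x"
    then have "c dvd r" "c dvd s" using rs(1,2) by (auto intro: dvd_trans)
    then have "c dvd r\<^sup>2 + s\<^sup>2" by (simp add: power2_eq_square)
    moreover have "c dvd 1 + (r\<^sup>2 + s\<^sup>2)" using c(2) by (simp add: x_def add.assoc)
    ultimately show "is_unit c" using dvd_add_left_iff by blast
  qed
  have one: "\<not> qdvd (int p ^ e) z" if "fst z = 1" for z
  proof -
    have "\<not> int p dvd 1" using ip by (auto simp: not_prime_unit)
    then have "\<not> int p ^ e dvd 1"
      using \<open>e > 0\<close> dvd_trans[of "int p" "int p ^ e" 1] by (auto simp: dvd_power)
    with that show ?thesis by (cases z rule: prod_cases4) auto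
  qed
  have xV: "qmod (int n) x \<in> V"
    unfolding V_def using ip rs(3)
    by (intro norm_dvd_vertexI[OF ip pn]) (auto simp: x_def)
  have yV: "qmod (int n) y \<in> V"
  proof -
    have "\<not> qdvd (int n) y" unfolding y_def dvd_y by (rule one) simp
    moreover have "\<not> qdvd (int n) (qscale (int p ^ e) (1, 0, 0, 0))"
      using \<open>k > 1\<close> p by (auto simp: nm prime_gt_0_nat)
    moreover have "qdvd (int n) (qmul y (qscale (int p ^ e) (1, 0, 0, 0)))"
      unfolding y_mul dvd_y by (simp add: qdvd_qscale)
    ultimately show ?thesis unfolding V_def using qmod_vertexI by blast
  qed
  have not_adj: "\<not> qdvd (int n) (qmul x y)" "\<not> qdvd (int n) (qmul y x)"
    unfolding y_mul dvd_y using one[of x] by (simp_all add: x_def)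
  have neq: "qmod (int n) x \<noteq> qmod (int n) y"
  proof
    assume "qmod (int n) x = qmod (int n) y"
    then have "int n dvd 1 - int k" by (simp add: x_def y_def mod_eq_dvd_iff)
    with kn have "int k dvd 1 - int k + int k" by (intro dvd_add) (auto intro: dvd_trans)
    with \<open>k > 1\<close> show False by simp
  qed
  have no_common: False
    if "\<not> qdvd (int n) w" "qdvd (int n) (qmul x w) \<or> qdvd (int n) (qmul w x)"
      "qdvd (int n) (qmul w y) \<or> qdvd (int n) (qmul y w)" for w
  proof -
    have "qdvd (int k) w"
      using that(2) qdvd_trans[OF kn] coprime_norm_cancel[OF norm_x] by blast
    moreover have "qdvd (int p ^ e) w"
      using that(3) by (simp add: y_mul dvd_y)
    ultimately have "qdvd (int n) w"
      unfolding nm using cop by (intro qdvd_coprime_mult) auto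
    with that(1) show False by contradiction
  qed
  have "(qmod (int n) x, qmod (int n) y) \<notin> S ^^ 2"
  proof
    assume "(qmod (int n) x, qmod (int n) y) \<in> S ^^ 2"
    then obtain w where w: "(qmod (int n) x, w) \<in> S" "(w, qmod (int n) y) \<in> S"
      unfolding numeral_2_eq_2 relpow.simps by blast
    have "w \<in> V" "qmod (int n) x = w \<or> qdvd (int n) (qmul x w) \<or> qdvd (int n) (qmul w x)"
      using w(1) by (simp_all add: S_def reflexive_arcs_def quaternions_mod_mult_eq_zero
          qdvd_qmul_qmod)
    moreover have "w = qmod (int n) y \<or> qdvd (int n) (qmul w y) \<or> qdvd (int n) (qmul y w)"
      using w(2) by (simp add: S_def reflexive_arcs_def quaternions_mod_mult_eq_zero
          qdvd_qmul_qmod)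
    moreover have "\<not> qdvd (int n) w"
      using \<open>w \<in> V\<close> quaternions_mod_vertexD(2) by (simp add: V_def)
    ultimately show False
      using no_common[of w] neq not_adj by (auto simp: qdvd_qmul_qmod)
  qed
  with xV yV show ?thesis
    unfolding zero_divisor_graph_eq numeral_eq_enat digraph_diameter_le_iff S_def V_def by blast
qed

end

section \<open>The diameters\<close>

theorem theorem7:
  fixes n :: nat
  assumes "n > 1"
  shows "digraph_diameter (zero_divisor_graph (quaternions_mod n))
           = digraph_diameter (zero_divisor_digraph (quaternions_mod n))
       \<and> digraph_diameter (zero_divisor_digraph (quaternions_mod n))
           = (if primepow n then 2 else 3)"
proof -
  let ?u = "digraph_diameter (zero_divisor_graph (quaternions_mod n))"
  let ?d = "digraph_diameter (zero_divisor_digraph (quaternions_mod n))"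
  have ud: "?u \<le> ?d" by (rule diameter_graph_le_digraph)
  have squeeze: "?u = ?d \<and> ?d = enat (Suc k)" if "?d \<le> enat (Suc k)" "\<not> ?u \<le> enat k" for k
    using ud that by (cases ?u; cases ?d) auto
  show ?thesis
  proof (cases "primepow n")
    case True
    then obtain p e where "prime p" "n = p ^ Suc e"
      by (auto simp: primepow_def gr0_conv_Suc simp del: power_Suc)
    with True show ?thesis
      using squeeze[of 1] diameter_le_2_if_prime_power[OF assms]
        diameter_not_le_1_if_prime_power[OF assms]
      by (simp add: numeral_eq_enat one_enat_def numeral_2_eq_2)
  next
    case False
    then show ?thesis
      using squeeze[of 2] diameter_not_le_2_if_not_prime_power[OF assms]
        ring.diameter_zero_divisor_digraph_le_3[OF quaternions_mod_ring[OF assms]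
          quaternions_mod_finite[OF assms]]
      by (simp add: numeral_eq_enat)
  qed
qed

end
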